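(* Let $P \subset \mathbb{R}^2$ be a lattice square (a square whose four vertices all lie in $\mathbb{Z}^2$) with area $A$. Then $P$ is $\mu_{\mathrm{av}}$-measurable, and \[\mu_{\mathrm{av}}(P) = \frac{2}{15}A.\]
   Context: Here $d=2$. A polytope is a $d$-dimensional convex polytope in $\mathbb{R}^d$. Two polytopes are similar ($M \sim P$) if one is the image of the other under a similarity transformation of $\mathbb{R}^d$ (a composition of an isometry and a dilation by a positive factor). A miniature of a polytope $P$ is a polytope $M \subset \mathbb{R}^d$ with $M \subset P$ and $M \sim P$. For an integer $n>0$, a miniature $M$ has resolution $n$ if every vertex of $M$ lies in $(\mathbb{Z}[1/n])^d$. Let $\mathcal{M}_n(P)$ denote the set of all miniatures of $P$ with resolution $n$. A lattice polytope $P$ is called $\mu_{\mathrm{av}}$-measurable if the limit \[\mu_{\mathrm{av}}(P) := \lim_{n\to\infty} \frac{\sum_{M \in \mathcal{M}_n(P)} \mathrm{vol}(M)}{\#\mathcal{M}_n(P)}\] exists in $\mathbb{R}$, where $\mathrm{vol}$ denotes $d$-dimensional volume (here area).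
   Formalization: Resolution n is taken to mean that every vertex of M has coordinates that are integer multiples of 1/n, rather than elements of the ring Z[1/n], which is dense for n ≥ 2 and would make the set of miniatures of resolution n infinite and the average undefined. *)

theory Defs
  imports "HOL-Analysis.Analysis"
begin

definition full_dim_polytope :: "(real^'n) set \<Rightarrow> bool" where
  "full_dim_polytope P \<longleftrightarrow> polytope P \<and> aff_dim P = int CARD('n)"

definition is_isometry :: "(real^'n \<Rightarrow> real^'n) \<Rightarrow> bool" where
  "is_isometry g \<longleftrightarrow> (\<forall>x y. dist (g x) (g y) = dist x y)"

definition dilation :: "real^'n \<Rightarrow> real \<Rightarrow> real^'n \<Rightarrow> real^'n" where
  "dilation a c x = a + c *\<^sub>R (x - a)"

definition similarity :: "(real^'n \<Rightarrow> real^'n) \<Rightarrow> bool" where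
  "similarity f \<longleftrightarrow> (\<exists>g a c. is_isometry g \<and> c > 0 \<and> f = dilation a c \<circ> g)"

definition similar :: "(real^'n) set \<Rightarrow> (real^'n) set \<Rightarrow> bool" where
  "similar M P \<longleftrightarrow> (\<exists>f. similarity f \<and> (M = f ` P \<or> P = f ` M))"

definition miniature :: "(real^'n) set \<Rightarrow> (real^'n) set \<Rightarrow> bool" where
  "miniature P M \<longleftrightarrow> full_dim_polytope M \<and> M \<subseteq> P \<and> similar M P"

text \<open>The set of admissible coordinates at resolution \<open>n\<close>, written \<open>\<int>[1/n]\<close> in the source, is
  read as the set of integer multiples of \<open>1/n\<close>, not as the ring generated by \<open>1/n\<close>: the latter is
  dense in the reals for \<open>n \<ge> 2\<close>, so that there would be infinitely many miniatures of
  resolution \<open>n\<close> and no average over them.\<close>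

definition grid :: "nat \<Rightarrow> (real^'n) set" where
  "grid n = {x. \<forall>i. \<exists>k::int. x $ i = of_int k / of_nat n}"

definition has_resolution :: "nat \<Rightarrow> (real^'n) set \<Rightarrow> bool" where
  "has_resolution n M \<longleftrightarrow> (\<forall>x. x extreme_point_of M \<longrightarrow> x \<in> grid n)"

definition miniatures :: "nat \<Rightarrow> (real^'n) set \<Rightarrow> (real^'n) set set" where
  "miniatures n P = {M. miniature P M \<and> has_resolution n M}"

definition lattice_polytope :: "(real^'n) set \<Rightarrow> bool" where
  "lattice_polytope P \<longleftrightarrow>
     full_dim_polytope P \<and> (\<forall>x. x extreme_point_of P \<longrightarrow> (\<forall>i. x $ i \<in> \<int>))"

definition miniature_average :: "(real^'n) set \<Rightarrow> nat \<Rightarrow> real" where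
  "miniature_average P n =
     (\<Sum>M\<in>miniatures n P. measure lebesgue M) / real (card (miniatures n P))"

definition mu_av_measurable :: "(real^'n) set \<Rightarrow> bool" where
  "mu_av_measurable P \<longleftrightarrow> lattice_polytope P \<and> convergent (miniature_average P)"

definition mu_av :: "(real^'n) set \<Rightarrow> real" where
  "mu_av P = lim (miniature_average P)"

definition is_square :: "(real^2) set \<Rightarrow> bool" where
  "is_square P \<longleftrightarrow> (\<exists>a u v. u \<noteq> 0 \<and> norm v = norm u \<and> u \<bullet> v = 0 \<and>
     P = convex hull {a, a + u, a + u + v, a + v})"

definition lattice_square :: "(real^2) set \<Rightarrow> bool" where
  "lattice_square P \<longleftrightarrow> is_square P \<and> (\<forall>x. x extreme_point_of P \<longrightarrow> (\<forall>i. x $ i \<in> \<int>))"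

text \<open>The sum and the cardinality in \<^const>\<open>miniature_average\<close> range over finite sets, so the default
  values for infinite index sets play no role.\<close>

lemma finite_grid_Int_bounded:
  fixes P :: "(real^'n) set"
  assumes "bounded P"
  shows "finite (grid n \<inter> P)"
proof -
  obtain B where B: "\<And>x. x \<in> P \<Longrightarrow> norm x \<le> B"
    using assms by (auto simp: bounded_iff)
  define b where "b = \<lceil>B * real n\<rceil>"
  let ?C = "(\<lambda>k. of_int k / of_nat n :: real) ` {- b..b} \<union> {0}"
  have "grid n \<inter> P \<subseteq> {x. \<forall>i. x $ i \<in> ?C}"
  proof (intro subsetI CollectI allI)
    fix x :: "real^'n" and i
    assume "x \<in> grid n \<inter> P"
    then have x: "x \<in> grid n" "x \<in> P" by auto
    show "x $ i \<in> ?C"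
    proof (cases "x $ i = 0")
      case nz: False
      obtain k :: int where k: "x $ i = of_int k / of_nat n"
        using x(1) by (auto simp: grid_def)
      have n: "real n > 0" using k nz by (cases "n = 0") auto
      have "\<bar>x $ i\<bar> \<le> B" using component_le_norm_cart[of x i] B[OF x(2)] by linarith
      then have "\<bar>real_of_int k\<bar> \<le> B * real n" using n k by (simp add: field_simps)
      then have "\<bar>k\<bar> \<le> b" unfolding b_def by linarith
      then have "k \<in> {- b..b}" by auto
      then show ?thesis unfolding k by blast
    qed simp
  qed
  moreover have "finite {x :: real^'n. \<forall>i. x $ i \<in> ?C}"
  proof (rule finite_imageD)
    have "vec_nth ` {x :: real^'n. \<forall>i. x $ i \<in> ?C} \<subseteq> Pi\<^sub>E UNIV (\<lambda>_. ?C)" by auto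
    then show "finite (vec_nth ` {x :: real^'n. \<forall>i. x $ i \<in> ?C})"
      by (rule finite_subset) (intro finite_PiE, auto)
    show "inj_on vec_nth {x :: real^'n. \<forall>i. x $ i \<in> ?C}"
      by (auto simp: inj_on_def vec_eq_iff)
  qed
  ultimately show ?thesis by (rule finite_subset)
qed

lemma finite_miniatures:
  assumes "bounded P"
  shows "finite (miniatures n P)"
proof -
  have "miniatures n P \<subseteq> (hull) convex ` Pow (grid n \<inter> P)"
  proof
    fix M assume "M \<in> miniatures n P"
    then have M: "polytope M" "M \<subseteq> P" "\<And>x. x extreme_point_of M \<Longrightarrow> x \<in> grid n"
      by (auto simp: miniatures_def miniature_def full_dim_polytope_def has_resolution_def)
    have "M = convex hull {x. x extreme_point_of M}"
      using M(1) by (intro Krein_Milman_Minkowski polytope_imp_compact polytope_imp_convex)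
    moreover have "{x. x extreme_point_of M} \<in> Pow (grid n \<inter> P)"
      using M by (auto simp: extreme_point_of_def)
    ultimately show "M \<in> (hull) convex ` Pow (grid n \<inter> P)" by blast
  qed
  then show ?thesis
    using finite_grid_Int_bounded[OF assms] by (meson finite_Pow_iff finite_imageI finite_subset)
qed

end

theory Submission
  imports Defs "HOL-Real_Asymp.Real_Asymp"
begin

text \<open>
  Let \<open>P\<close> have corner \<open>a\<close> and side vectors \<open>u\<close>, \<open>iu\<close>, and use coordinates with respect to \<open>u / n\<close>, \<open>iu / n\<close>, so
  that \<open>P\<close> becomes \<open>[0, n]\<^sup>2\<close>. A square has exactly one side vector \<open>(s, t)\<close>, taken anticlockwise, with
  \<open>s > 0\<close> and \<open>t \<ge> 0\<close>; if it starts at \<open>(x, y)\<close>, the bounding box of the square is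
  \<open>[x - t, x + s] \<times> [y, y + s + t]\<close>. The miniatures of resolution \<open>n\<close> are therefore the points of
  \<open>L \<times> L\<close>, for a fixed planar lattice \<open>L \<supseteq> \<int>\<^sup>2\<close>, in a polytope described by linear inequalities.
  Splitting \<open>L\<close> into its \<open>k\<close> cosets of \<open>\<int>\<^sup>2\<close> and rounding compares the sums over these points with \<open>k\<^sup>2\<close> times the
  same sums over integer points for \<open>n - 4\<close> and \<open>n + 2\<close>. Those are polynomials in \<open>n\<close>: about
  \<open>n\<^sup>4 / 12\<close> points, and \<open>n\<^sup>6 / 90\<close> for the sum of \<open>s\<^sup>2 + t\<^sup>2\<close>. The area of a miniature is
  \<open>A (s\<^sup>2 + t\<^sup>2) / n\<^sup>2\<close>, so that the average tends to \<open>12 A / 90\<close>.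
\<close>

section \<open>Squares in the plane\<close>

definition rot90 :: "real^2 \<Rightarrow> real^2" where
  "rot90 x = vector [- x$2, x$1]"

lemma rot90_nth [simp]: "rot90 x $ 1 = - x$2" "rot90 x $ 2 = x$1"
  by (simp_all add: rot90_def)

text \<open>With \<open>real^2\<close> read as the complex plane, \<open>rot90\<close> is
  multiplication by i and \<open>frame u x y\<close> is the product of u and x + iy. Hence norms
  multiply, and successive factors commute.\<close>

definition frame :: "real^2 \<Rightarrow> real \<Rightarrow> real \<Rightarrow> real^2" where
  "frame u x y = x *\<^sub>R u + y *\<^sub>R rot90 u"

lemma frame_nth [simp]:
  "frame u x y $ 1 = x * u$1 - y * u$2" "frame u x y $ 2 = x * u$2 + y * u$1"
  by (simp_all add: frame_def)

lemma frame_add: "frame u (x + x') (y + y') = frame u x y + frame u x' y'"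
  by (simp add: vec_eq_iff forall_2 algebra_simps)

lemma frame_diff: "frame u (x - x') (y - y') = frame u x y - frame u x' y'"
  by (simp add: vec_eq_iff forall_2 algebra_simps)

lemma frame_scale: "frame u (c * x) (c * y) = c *\<^sub>R frame u x y"
  by (simp add: vec_eq_iff forall_2 algebra_simps)

lemma rot90_frame: "rot90 (frame u x y) = frame u (- y) x"
  by (simp add: vec_eq_iff forall_2 algebra_simps)

lemma frame_simple [simp]: "frame u 0 0 = 0" "frame u 1 0 = u" "frame u 0 1 = rot90 u"
  by (simp_all add: frame_def)

lemma vec2_nonzero_iff: "(u::real^2) \<noteq> 0 \<longleftrightarrow> (u$1)\<^sup>2 + (u$2)\<^sup>2 > 0"
  by (auto simp: vec_eq_iff forall_2 sum_power2_gt_zero_iff)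

lemma norm_vec2: "norm (u::real^2) = sqrt ((u$1)\<^sup>2 + (u$2)\<^sup>2)"
  by (simp add: norm_eq_sqrt_inner inner_vec_def sum_2 power2_eq_square)

lemma norm_frame: "norm (frame u x y) = sqrt (x\<^sup>2 + y\<^sup>2) * norm u"
  unfolding norm_vec2 real_sqrt_mult[symmetric]
  by (rule arg_cong[where f = sqrt]) (simp add: power2_eq_square algebra_simps)

lemma frame_eq_0_iff: "u \<noteq> 0 \<Longrightarrow> frame u x y = 0 \<longleftrightarrow> x = 0 \<and> y = 0"
  using norm_frame[of u x y] by (metis frame_simple(1) mult_eq_0_iff norm_eq_zero
      real_sqrt_eq_zero_cancel_iff sum_power2_eq_zero_iff)

lemma frame_eq_iff: "u \<noteq> 0 \<Longrightarrow> frame u x y = frame u x' y' \<longleftrightarrow> x = x' \<and> y = y'"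
  using frame_eq_0_iff[of u "x - x'" "y - y'"] by (simp add: frame_diff)

lemma frame_surj:
  assumes "u \<noteq> 0"
  obtains x y where "w = frame u x y"
proof
  let ?d = "(u$1)\<^sup>2 + (u$2)\<^sup>2"
  have d: "?d > 0" using assms vec2_nonzero_iff by blast
  have "w$1 * ?d = (w$1 * u$1 + w$2 * u$2) * u$1 - (w$2 * u$1 - w$1 * u$2) * u$2"
    "w$2 * ?d = (w$1 * u$1 + w$2 * u$2) * u$2 + (w$2 * u$1 - w$1 * u$2) * u$1"
    by (simp_all add: power2_eq_square algebra_simps)
  \<comment> \<open>These are the real and imaginary parts of w times the conjugate of u, divided by
    |u|^2.\<close>
  with d show "w = frame u ((w$1 * u$1 + w$2 * u$2) / ?d) ((w$2 * u$1 - w$1 * u$2) / ?d)"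
    by (auto simp: vec_eq_iff forall_2 eq_divide_eq simp flip: diff_divide_distrib add_divide_distrib)
qed

section \<open>Squares given by a corner and an anticlockwise side vector\<close>

definition sqset :: "real^2 \<Rightarrow> real^2 \<Rightarrow> (real^2) set" where
  "sqset a u = {a + frame u x y |x y. 0 \<le> x \<and> x \<le> 1 \<and> 0 \<le> y \<and> y \<le> 1}"

lemma mem_sqset_iff:
  assumes "u \<noteq> 0"
  shows "a + frame u x y \<in> sqset a u \<longleftrightarrow> 0 \<le> x \<and> x \<le> 1 \<and> 0 \<le> y \<and> y \<le> 1"
  by (auto simp: sqset_def frame_eq_iff[OF assms])

lemma convex_sqset: "convex (sqset a u)"
proof (rule convexI)
  fix p q and c d :: real
  assume "p \<in> sqset a u" "q \<in> sqset a u" and cd: "0 \<le> c" "0 \<le> d" "c + d = 1"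
  then obtain x y x' y' where p: "p = a + frame u x y" and q: "q = a + frame u x' y'"
    and b: "0 \<le> x" "x \<le> 1" "0 \<le> y" "y \<le> 1" "0 \<le> x'" "x' \<le> 1" "0 \<le> y'" "y' \<le> 1"
    by (auto simp: sqset_def)
  have "c *\<^sub>R p + d *\<^sub>R q = (c + d) *\<^sub>R a + frame u (c * x + d * x') (c * y + d * y')"
    by (simp add: p q frame_add frame_scale algebra_simps)
  moreover have "0 \<le> c * x + d * x'" "c * x + d * x' \<le> 1" "0 \<le> c * y + d * y'" "c * y + d * y' \<le> 1"
    using b cd by (auto intro!: convex_bound_le)
  ultimately show "c *\<^sub>R p + d *\<^sub>R q \<in> sqset a u"
    unfolding sqset_def mem_Collect_eq using cd(3)
    by (intro exI[of _ "c * y + d * y'"] exI[of _ "c * x + d * x'"]) simp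
qed

lemma sqset_hull: "convex hull {a, a + u, a + u + rot90 u, a + rot90 u} = sqset a u" (is "convex hull ?V = _")
proof
  have "a \<in> sqset a u" "a + u \<in> sqset a u" "a + u + rot90 u \<in> sqset a u" "a + rot90 u \<in> sqset a u"
    unfolding sqset_def
    by (force intro: exI[of _ 0] exI[of _ "1::real"] simp: frame_def)+
  then show "convex hull ?V \<subseteq> sqset a u"
    by (intro hull_minimal convex_sqset) auto
  show "sqset a u \<subseteq> convex hull ?V"
  proof
    fix p assume "p \<in> sqset a u"
    then obtain x y where p: "p = a + frame u x y" and b: "0 \<le> x" "x \<le> 1" "0 \<le> y" "y \<le> 1"
      by (auto simp: sqset_def)
    have c: "convex (convex hull ?V)" by simp
    \<comment> \<open>Interpolate first along the two sides in direction \<open>rot90 u\<close>,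
      then between the two points found.\<close>
    have "(1 - y) *\<^sub>R a + y *\<^sub>R (a + rot90 u) \<in> convex hull ?V"
      "(1 - y) *\<^sub>R (a + u) + y *\<^sub>R (a + u + rot90 u) \<in> convex hull ?V"
      using b by (auto intro!: convexD_alt[OF c] intro: hull_inc)
    then have "(1 - x) *\<^sub>R ((1 - y) *\<^sub>R a + y *\<^sub>R (a + rot90 u))
        + x *\<^sub>R ((1 - y) *\<^sub>R (a + u) + y *\<^sub>R (a + u + rot90 u)) \<in> convex hull ?V"
      using b by (auto intro!: convexD_alt[OF c])
    also have "(1 - x) *\<^sub>R ((1 - y) *\<^sub>R a + y *\<^sub>R (a + rot90 u))
        + x *\<^sub>R ((1 - y) *\<^sub>R (a + u) + y *\<^sub>R (a + u + rot90 u)) = p"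
      by (simp add: p frame_def algebra_simps)
    finally show "p \<in> convex hull ?V" .
  qed
qed

text \<open>Moving on to the next corner anticlockwise only permutes the four vertices. This carries
  facts about one corner over to the others.\<close>

lemma sqset_rot: "sqset (a + u) (rot90 u) = sqset a u"
proof -
  have rr: "rot90 (rot90 u) = - u" by (simp add: vec_eq_iff forall_2)
  have "{a + u, a + u + rot90 u, a + u + rot90 u + rot90 (rot90 u), a + u + rot90 (rot90 u)}
      = {a, a + u, a + u + rot90 u, a + rot90 u}"
    by (auto simp: rr)
  then show ?thesis by (simp flip: sqset_hull)
qed

text \<open>\<open>is_square\<close> admits both orientations of the pair of sides,
  \<open>sqset\<close> only one. Orthogonality leaves a multiple y of \<open>rot90 u\<close>, equal
  norms give |y| = 1, and for y = -1 the two vectors swap roles.\<close>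

lemma orthogonal_same_norm_cases:
  fixes u v :: "real^2"
  assumes "u \<noteq> 0" "norm v = norm u" "u \<bullet> v = 0"
  shows "v = rot90 u \<or> u = rot90 v"
proof -
  obtain x y where v: "v = frame u x y" using frame_surj[OF assms(1)] .
  have "u \<bullet> v = x * (u \<bullet> u)"
    by (simp add: v inner_vec_def sum_2 algebra_simps)
  then have x: "x = 0" using assms by simp
  then have "\<bar>y\<bar> = 1" using assms(1,2) norm_frame[of u x y] by (simp add: v)
  then show ?thesis
    by (auto simp: v x abs_if vec_eq_iff forall_2 split: if_splits)
qed

lemma hull_orthogonal_eq_sqset:
  fixes u v :: "real^2"
  assumes "u \<noteq> 0" "norm v = norm u" "u \<bullet> v = 0"
  obtains w where "w \<noteq> 0" "convex hull {a, a + u, a + u + v, a + v} = sqset a w"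
proof (cases "v = rot90 u")
  case True
  then show ?thesis using that[of u] assms(1) by (simp add: sqset_hull)
next
  case False
  then have "u = rot90 v" using orthogonal_same_norm_cases[OF assms] by blast
  moreover have "{a, a + u, a + u + v, a + v} = {a, a + v, a + v + u, a + u}"
    by (auto simp: algebra_simps)
  ultimately have "convex hull {a, a + u, a + u + v, a + v} = sqset a v"
    by (simp add: sqset_hull)
  moreover have "v \<noteq> 0" using assms by auto
  ultimately show ?thesis using that by blast
qed

lemma norm_rot90 [simp]: "norm (rot90 u) = norm u"
  by (simp add: norm_vec2 add.commute)

lemma inner_rot90 [simp]: "u \<bullet> rot90 u = 0"
  by (simp add: inner_vec_def sum_2)

lemma is_square_iff_sqset: "is_square P \<longleftrightarrow> (\<exists>a u. u \<noteq> 0 \<and> P = sqset a u)"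
proof
  assume "is_square P"
  then show "\<exists>a u. u \<noteq> 0 \<and> P = sqset a u"
    unfolding is_square_def by (metis hull_orthogonal_eq_sqset)
next
  assume "\<exists>a u. u \<noteq> 0 \<and> P = sqset a u"
  then show "is_square P"
    unfolding is_square_def by (metis sqset_hull norm_rot90 inner_rot90)
qed

text \<open>Points of the square have nonnegative coordinates relative to a. If a combination with
  positive weights has both coordinates 0, so do the two points, which then coincide.\<close>

lemma corner_extreme_point_sqset:
  assumes "u \<noteq> 0"
  shows "a extreme_point_of sqset a u"
  unfolding extreme_point_of_def
proof (intro conjI ballI notI)
  show "a \<in> sqset a u" using mem_sqset_iff[OF assms, of a 0 0] by simp
next
  fix p q assume "p \<in> sqset a u" "q \<in> sqset a u" and seg: "a \<in> open_segment p q"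
  then obtain x y x' y' where p: "p = a + frame u x y" and q: "q = a + frame u x' y'"
    and b: "0 \<le> x" "0 \<le> y" "0 \<le> x'" "0 \<le> y'"
    by (auto simp: sqset_def)
  obtain c where c: "0 < c" "c < 1" "a = (1 - c) *\<^sub>R p + c *\<^sub>R q" and "p \<noteq> q"
    using seg by (auto simp: in_segment)
  have "(1 - c) *\<^sub>R p + c *\<^sub>R q = a + frame u ((1 - c) * x + c * x') ((1 - c) * y + c * y')"
    by (simp add: p q vec_eq_iff forall_2 algebra_simps)
  with c have "frame u ((1 - c) * x + c * x') ((1 - c) * y + c * y') = 0" by simp
  then have "(1 - c) * x + c * x' = 0" "(1 - c) * y + c * y' = 0"
    by (simp_all add: frame_eq_0_iff[OF assms])
  then have "x = 0" "x' = 0" "y = 0" "y' = 0"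
    using b c by (auto simp: add_nonneg_eq_0_iff)
  then show False using \<open>p \<noteq> q\<close> by (simp add: p q)
qed

lemma extreme_point_of_sqset_iff:
  assumes "u \<noteq> 0"
  shows "x extreme_point_of sqset a u \<longleftrightarrow> x \<in> {a, a + u, a + u + rot90 u, a + rot90 u}"
proof
  show "x extreme_point_of sqset a u \<Longrightarrow> x \<in> {a, a + u, a + u + rot90 u, a + rot90 u}"
    unfolding sqset_hull[symmetric] by (rule extreme_point_of_convex_hull)
next
  have r: "rot90 w \<noteq> 0" if "w \<noteq> 0" for w using that by (metis norm_rot90 norm_eq_zero)
  have rr: "rot90 (rot90 u) = - u" by (simp add: vec_eq_iff forall_2)
  have "a + u extreme_point_of sqset a u"
    using corner_extreme_point_sqset[of "rot90 u" "a + u"] assms r sqset_rot by simp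
  moreover have "a + u + rot90 u extreme_point_of sqset a u"
    using corner_extreme_point_sqset[of "rot90 (rot90 u)" "a + u + rot90 u"] assms r sqset_rot
    by metis
  moreover have "a + u + rot90 u + rot90 (rot90 u) extreme_point_of sqset a u"
    using corner_extreme_point_sqset[of "rot90 (rot90 (rot90 u))" "a + u + rot90 u + rot90 (rot90 u)"]
      assms r sqset_rot by metis
  moreover have "a extreme_point_of sqset a u"
    by (rule corner_extreme_point_sqset[OF assms])
  ultimately show "x \<in> {a, a + u, a + u + rot90 u, a + rot90 u} \<Longrightarrow> x extreme_point_of sqset a u"
    by (auto simp: rr)
qed

lemma full_dim_polytope_sqset:
  assumes "u \<noteq> 0"
  shows "full_dim_polytope (sqset a u)"
proof -
  have "polytope (sqset a u)"
    unfolding sqset_hull[symmetric] by (simp add: polytope_convex_hull)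
  moreover have "affine hull sqset a u = UNIV"
  proof -
    have "p \<in> affine hull sqset a u" for p
    proof -
      obtain x y where xy: "p - a = frame u x y" using frame_surj[OF assms] .
      have "a \<in> affine hull sqset a u" "a + u \<in> affine hull sqset a u"
        "a + rot90 u \<in> affine hull sqset a u"
        using mem_sqset_iff[OF assms, of a 0 0] mem_sqset_iff[OF assms, of a 1 0]
          mem_sqset_iff[OF assms, of a 0 1] by (auto intro: hull_inc)
      then have "(1 - x - y) *\<^sub>R a + x *\<^sub>R (a + u) + y *\<^sub>R (a + rot90 u) \<in> affine hull sqset a u"
        by (intro mem_affine_3) auto
      also have "(1 - x - y) *\<^sub>R a + x *\<^sub>R (a + u) + y *\<^sub>R (a + rot90 u) = a + frame u x y"
        by (simp add: frame_def algebra_simps)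
      finally show ?thesis by (simp flip: xy)
    qed
    then show ?thesis by blast
  qed
  ultimately show ?thesis
    by (simp add: full_dim_polytope_def flip: aff_dim_eq_full[where 'n = "real^2", simplified])
qed

section \<open>Similarities\<close>

text \<open>An isometry becomes orthogonal once its value at the origin is subtracted. That value
  and the centre of the dilation are absorbed into the translation vector b.\<close>

lemma similarity_iff:
  "similarity f \<longleftrightarrow> (\<exists>b c h. c > 0 \<and> orthogonal_transformation h \<and> f = (\<lambda>x. b + c *\<^sub>R h x))"
proof
  assume "similarity f"
  then obtain g a c where g: "is_isometry g" and c: "c > 0" and f: "f = dilation a c \<circ> g"
    by (auto simp: similarity_def)
  define h where "h = (\<lambda>x. g x - g 0)"
  have "orthogonal_transformation h"
    using g by (simp add: orthogonal_transformation_isometry h_def is_isometry_def dist_norm)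
  moreover have "f = (\<lambda>x. (a + c *\<^sub>R (g 0 - a)) + c *\<^sub>R h x)"
    by (simp add: f h_def dilation_def fun_eq_iff algebra_simps)
  ultimately show "\<exists>b c h. c > 0 \<and> orthogonal_transformation h \<and> f = (\<lambda>x. b + c *\<^sub>R h x)"
    using c by blast
next
  assume "\<exists>b c h. c > 0 \<and> orthogonal_transformation h \<and> f = (\<lambda>x. b + c *\<^sub>R h x)"
  then obtain b c h where c: "c > 0" and h: "orthogonal_transformation h"
    and f: "f = (\<lambda>x. b + c *\<^sub>R h x)" by blast
  have "is_isometry (\<lambda>x. (1 / c) *\<^sub>R b + h x)"
    using h by (simp add: is_isometry_def orthogonal_transformation_isometry)
  moreover have "f = dilation 0 c \<circ> (\<lambda>x. (1 / c) *\<^sub>R b + h x)"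
    using c by (simp add: f dilation_def fun_eq_iff algebra_simps)
  ultimately show "similarity f"
    using c unfolding similarity_def by blast
qed

text \<open>\<open>similar\<close> lets the similarity run in either direction; an inverse reduces
  the case where P is the image of M to the other one.\<close>

lemma similarity_left_inverse:
  assumes "similarity f"
  obtains f' where "similarity f'" "\<And>x. f' (f x) = x"
proof -
  obtain b c h where c: "c > 0" and h: "orthogonal_transformation h"
    and f: "f = (\<lambda>x. b + c *\<^sub>R h x)" using assms by (auto simp: similarity_iff)
  define k where "k = inv h"
  have k: "orthogonal_transformation k" and kh: "k (h x) = x" for x
    using h by (auto simp: k_def orthogonal_transformation_inv orthogonal_transformation_inj)
  have lin: "linear k" using k by (simp add: orthogonal_transformation_def)
  define f' where "f' = (\<lambda>x. - (1 / c) *\<^sub>R k b + (1 / c) *\<^sub>R k x)"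
  have "similarity f'"
    unfolding similarity_iff f'_def using c k
    by (intro exI[of _ "- (1 / c) *\<^sub>R k b"] exI[of _ "1 / c"] exI[of _ k]) simp
  moreover have "f' (f x) = x" for x
    using c by (simp add: f'_def f linear_add[OF lin] linear_scale[OF lin] kh algebra_simps)
  ultimately show ?thesis using that by blast
qed

text \<open>The orthogonal part may be a reflection, so the argument uses \<open>is_square\<close>,
  which prescribes no orientation, rather than \<open>sqset\<close>.\<close>

lemma is_square_similarity_image:
  assumes "similarity f" "is_square P"
  shows "is_square (f ` P)"
proof -
  obtain b c h where c: "c > 0" and h: "orthogonal_transformation h"
    and f: "f = (\<lambda>x. b + c *\<^sub>R h x)" using assms by (auto simp: similarity_iff)
  obtain a u v where u: "u \<noteq> 0" "norm v = norm u" "u \<bullet> v = 0"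
    and P: "P = convex hull {a, a + u, a + u + v, a + v}"
    using assms(2) by (auto simp: is_square_def)
  define k where "k = (\<lambda>x. c *\<^sub>R h x)"
  have lin: "linear k" unfolding k_def using h
    by (simp add: orthogonal_transformation_def linear_compose_scale_right)
  have "f ` P = (+) b ` k ` P" by (simp add: f k_def image_image)
  also have "\<dots> = convex hull ((+) b ` k ` {a, a + u, a + u + v, a + v})"
    unfolding P by (simp only: convex_hull_linear_image[OF lin] convex_hull_translation)
  also have "(+) b ` k ` {a, a + u, a + u + v, a + v}
      = {b + k a, b + k a + k u, b + k a + k u + k v, b + k a + k v}"
    by (simp add: linear_add[OF lin] add.assoc)
  finally have "f ` P = convex hull \<dots>" .
  moreover have norm_k: "norm (k x) = c * norm x" for x
    using c h by (simp add: k_def orthogonal_transformation_norm)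
  moreover have "k u \<noteq> 0"
    using norm_k[of u] u(1) c by auto
  moreover have "k u \<bullet> k v = 0"
    using u h by (simp add: k_def orthogonal_transformation_def)
  ultimately show ?thesis
    unfolding is_square_def using u c
    by (intro exI[of _ "b + k a"] exI[of _ "k u"] exI[of _ "k v"])
       auto
qed

lemma is_square_if_similar:
  assumes "similar M P" "is_square P"
  shows "is_square M"
proof -
  obtain f where f: "similarity f" "M = f ` P \<or> P = f ` M"
    using assms(1) by (auto simp: similar_def)
  from f(2) show ?thesis
  proof
    assume "M = f ` P"
    then show ?thesis using is_square_similarity_image[OF f(1) assms(2)] by simp
  next
    assume P: "P = f ` M"
    obtain f' where "similarity f'" "\<And>x. f' (f x) = x" by (rule similarity_left_inverse[OF f(1)]) blast
    then have "M = f' ` P" by (simp add: P image_image)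
    then show ?thesis using is_square_similarity_image[OF \<open>similarity f'\<close> assms(2)] by simp
  qed
qed

lemma linear_frame: "linear (\<lambda>z. frame z s t)"
  by (rule linearI) (simp_all add: vec_eq_iff forall_2 algebra_simps)

lemma frame_frame: "frame (frame u x y) s t = frame (frame u s t) x y"
  by (simp add: vec_eq_iff forall_2 algebra_simps)

text \<open>Multiplication by s + it takes the side vector u to \<open>frame u s t\<close>; the
  translation then moves the image of a to b.\<close>

lemma sqset_image: "sqset b (frame u s t) = (\<lambda>z. b - frame a s t + frame z s t) ` sqset a u"
proof -
  have "b + frame (frame u s t) x y = b - frame a s t + frame (a + frame u x y) s t" for x y
    by (simp add: linear_add[OF linear_frame] frame_frame[of u x y])
  moreover have "(\<lambda>z. b - frame a s t + frame z s t) ` sqset a u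
      = {b - frame a s t + frame (a + frame u x y) s t |x y. 0 \<le> x \<and> x \<le> 1 \<and> 0 \<le> y \<and> y \<le> 1}"
    unfolding sqset_def by blast
  ultimately show ?thesis by (simp only: sqset_def[of b])
qed

lemma similar_sqset:
  assumes "u \<noteq> 0" "w \<noteq> 0"
  shows "similar (sqset b w) (sqset a u)"
proof -
  obtain s t where w: "w = frame u s t" using frame_surj[OF assms(1)] .
  define c where "c = sqrt (s\<^sup>2 + t\<^sup>2)"
  have "c \<noteq> 0" using assms(2) unfolding c_def w by auto
  then have c: "c > 0" by (simp add: c_def less_le)
  \<comment> \<open>Division by c, the modulus of s + it, leaves a rotation.\<close>
  have "orthogonal_transformation (\<lambda>z. (1 / c) *\<^sub>R frame z s t)"
    unfolding orthogonal_transformation using c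
    by (auto intro!: linear_compose_scale_right linear_frame simp: norm_frame c_def)
  then have "similarity (\<lambda>z. b - frame a s t + c *\<^sub>R ((1 / c) *\<^sub>R frame z s t))"
    unfolding similarity_iff using c by blast
  then show ?thesis
    unfolding similar_def w sqset_image[of b u s t a] using c by auto
qed

lemma measure_sqset_frame:
  "measure lebesgue (sqset b (frame u s t)) = (s\<^sup>2 + t\<^sup>2) * measure lebesgue (sqset a u)"
proof -
  have "sqset b (frame u s t) = (+) (b - frame a s t) ` (\<lambda>z. frame z s t) ` sqset a u"
    by (subst sqset_image[of _ _ _ _ a]) (simp add: image_image)
  then have "measure lebesgue (sqset b (frame u s t)) = measure lebesgue ((\<lambda>z. frame z s t) ` sqset a u)"
    by (simp only: measure_translation)
  also have "sqset a u \<in> lmeasurable"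
    unfolding sqset_hull[symmetric] by (intro lmeasurable_compact finite_imp_compact_convex_hull) simp
  then have "measure lebesgue ((\<lambda>z. frame z s t) ` sqset a u)
      = \<bar>det (matrix (\<lambda>z. frame z s t))\<bar> * measure lebesgue (sqset a u)"
    by (intro measure_linear_image linear_frame)
  also have "det (matrix (\<lambda>z. frame z s t)) = s\<^sup>2 + t\<^sup>2"
    by (simp add: det_2 matrix_def axis_def power2_eq_square)
  finally show ?thesis by simp
qed

section \<open>Parametrising the miniatures\<close>

lemma mem_sqset_frame_iff:
  assumes "u \<noteq> 0"
  shows "a + frame u x' y' \<in> sqset (a + frame u x y) (frame u s t) \<longleftrightarrow>
    (\<exists>p q. 0 \<le> p \<and> p \<le> 1 \<and> 0 \<le> q \<and> q \<le> 1 \<and> x' = x + p * s - q * t \<and> y' = y + p * t + q * s)"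
proof -
  have eq: "a + frame u x y + frame (frame u s t) p q
      = a + frame u (x + p * s - q * t) (y + p * t + q * s)" for p q
    by (simp add: vec_eq_iff forall_2 algebra_simps)
  show ?thesis
    unfolding sqset_def eq by (auto simp: frame_eq_iff[OF assms])
qed

text \<open>In coordinates along u the small square has bounding box [x - t, x + s] x
  [y, y + s + t], and each side of the box contains a corner of the square. The four inequalities
  put this box inside the unit square.\<close>

lemma sqset_frame_subset_iff:
  assumes u: "u \<noteq> 0" and st: "0 \<le> s" "0 \<le> t"
  shows "sqset (a + frame u x y) (frame u s t) \<subseteq> sqset a u
    \<longleftrightarrow> t \<le> x \<and> x + s \<le> 1 \<and> 0 \<le> y \<and> y + s + t \<le> 1" (is "?M \<subseteq> _ \<longleftrightarrow> ?R")
proof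
  assume sub: "?M \<subseteq> sqset a u"
  have "a + frame u (x + p * s - q * t) (y + p * t + q * s) \<in> ?M"
    if "0 \<le> p" "p \<le> 1" "0 \<le> q" "q \<le> 1" for p q
    using that unfolding mem_sqset_frame_iff[OF u] by blast
  with sub have *: "a + frame u (x + p * s - q * t) (y + p * t + q * s) \<in> sqset a u"
    if "0 \<le> p" "p \<le> 1" "0 \<le> q" "q \<le> 1" for p q
    using that by blast
  show ?R
    using *[of 0 0] *[of 1 0] *[of 0 1] *[of 1 1] by (simp add: mem_sqset_iff[OF u])
next
  assume b: ?R
  show "?M \<subseteq> sqset a u"
  proof
    fix z assume z: "z \<in> ?M"
    obtain x' y' where "z - a = frame u x' y'" using frame_surj[OF u] .
    then have z': "z = a + frame u x' y'" by (simp add: algebra_simps)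
    then obtain p q where xy: "x' = x + p * s - q * t" "y' = y + p * t + q * s"
      and pq: "0 \<le> p" "p \<le> 1" "0 \<le> q" "q \<le> 1"
      using z by (auto simp: mem_sqset_frame_iff[OF u])
    have "0 \<le> p * s" "p * s \<le> s" "0 \<le> q * t" "q * t \<le> t" "0 \<le> p * t" "p * t \<le> t" "0 \<le> q * s" "q * s \<le> s"
      using pq st by (auto simp: mult_left_le_one_le)
    then show "z \<in> sqset a u"
      unfolding z' mem_sqset_iff[OF u] xy using b by linarith
  qed
qed

text \<open>The lower, left and right sides of the bounding boxes are compared. The last claim
  breaks the tie for t = 0, when a whole edge lies at the lowest height: since s > 0, a point at
  height y has q = 0. Applied in both directions, the bounds show that a square determines its
  parameters.\<close>

lemma sqset_frame_subset_bounds: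
  assumes u: "u \<noteq> 0" and st: "0 < s" "0 \<le> t"
    and sub: "sqset (a + frame u x' y') (frame u s' t') \<subseteq> sqset (a + frame u x y) (frame u s t)"
  shows "y \<le> y'" "x - t \<le> x' - t'" "x' + s' \<le> x + s" "y' = y \<Longrightarrow> x \<le> x'"
proof -
  have "a + frame u x' y' \<in> sqset (a + frame u x' y') (frame u s' t')"
    "a + frame u (x' - t') (y' + s') \<in> sqset (a + frame u x' y') (frame u s' t')"
    "a + frame u (x' + s') (y' + t') \<in> sqset (a + frame u x' y') (frame u s' t')"
    unfolding mem_sqset_frame_iff[OF u]
    by (rule exI[of _ 0], rule exI[of _ 0], simp, rule exI[of _ 0], rule exI[of _ 1], simp,
        rule exI[of _ 1], rule exI[of _ 0], simp)
  then have v: "a + frame u x' y' \<in> sqset (a + frame u x y) (frame u s t)"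
    "a + frame u (x' - t') (y' + s') \<in> sqset (a + frame u x y) (frame u s t)"
    "a + frame u (x' + s') (y' + t') \<in> sqset (a + frame u x y) (frame u s t)"
    using sub by blast+
  have b: "0 \<le> p * s" "p * s \<le> s" "0 \<le> p * t" "p * t \<le> t" if "0 \<le> p" "p \<le> 1" for p
    using that st by (auto simp: mult_left_le_one_le)
  obtain p q where pq: "0 \<le> p" "p \<le> 1" "0 \<le> q" "q \<le> 1" "x' = x + p * s - q * t" "y' = y + p * t + q * s"
    using v(1) unfolding mem_sqset_frame_iff[OF u] by blast
  show "y \<le> y'" using pq b[of p] b[of q] by linarith
  show "x \<le> x'" if "y' = y"
  proof -
    have "q * s = 0" using that pq b[of p] b[of q] by linarith
    then have "q = 0" using st by simp
    then show ?thesis using pq b[of p] by simp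
  qed
  obtain p q where "0 \<le> p" "p \<le> 1" "0 \<le> q" "q \<le> 1" "x' - t' = x + p * s - q * t"
    using v(2) unfolding mem_sqset_frame_iff[OF u] by blast
  then show "x - t \<le> x' - t'" using b[of p] b[of q] by linarith
  obtain p q where "0 \<le> p" "p \<le> 1" "0 \<le> q" "q \<le> 1" "x' + s' = x + p * s - q * t"
    using v(3) unfolding mem_sqset_frame_iff[OF u] by blast
  then show "x' + s' \<le> x + s" using b[of p] b[of q] by linarith
qed

lemma sqset_frame_inject:
  assumes "u \<noteq> 0" "0 < s" "0 \<le> t" "0 < s'" "0 \<le> t'"
    and "sqset (a + frame u x y) (frame u s t) = sqset (a + frame u x' y') (frame u s' t')"
  shows "x = x' \<and> y = y' \<and> s = s' \<and> t = t'"
proof -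
  note A = sqset_frame_subset_bounds[OF assms(1-3) equalityD2[OF assms(6)]]
  note B = sqset_frame_subset_bounds[OF assms(1,4,5) equalityD1[OF assms(6)]]
  have y: "y = y'" using A(1) B(1) by simp
  moreover from y have "x = x'" using A(4) B(4) by simp
  ultimately show ?thesis using A(2,3) B(2,3) by simp
qed

text \<open>The side vectors of a square differ by quarter turns, and the four half-open quadrants
  partition the nonzero vectors. At most three clockwise turns, each a use of \<open>rot\<close>,
  reach the quadrant s > 0, t >= 0.\<close>

lemma sqset_canonical_corner:
  assumes "u \<noteq> 0" "w \<noteq> 0"
  obtains b' s t where "0 < s" "0 \<le> t" "sqset b w = sqset b' (frame u s t)"
proof -
  obtain s t where w: "w = frame u s t" using frame_surj[OF assms(1)] .
  have rot: "sqset b (frame u s t) = sqset (b - frame u t (- s)) (frame u t (- s))" for b s t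
    using sqset_rot[of "b - frame u t (- s)" "frame u t (- s)"] by (simp add: rot90_frame)
  consider "0 < s" "0 \<le> t" | "0 < t" "s \<le> 0" | "s < 0" "t \<le> 0" | "t < 0" "0 \<le> s"
    using assms(2) unfolding w
    by (cases s "0::real" rule: linorder_cases; cases t "0::real" rule: linorder_cases) auto
  then show ?thesis
  proof cases
    case 1
    then show ?thesis using that[of s t b] w by simp
  next
    case 2
    then show ?thesis using that[OF _ _ rot[of b s t, folded w]] by simp
  next
    case 3
    then show ?thesis using that[OF _ _ trans[OF rot[of b s t, folded w] rot]] by simp
  next
    case 4
    then show ?thesis using that[OF _ _ trans[OF rot[of b s t, folded w] trans[OF rot rot]]] by simp
  qed
qed

text \<open>For nonzero u this is the lattice of Gaussian integers divided by u. It contains Z^2 as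
  soon as u has integer entries.\<close>

definition latt :: "real^2 \<Rightarrow> (real \<times> real) set" where
  "latt u = {(x, y). \<forall>i. frame u x y $ i \<in> \<int>}"

text \<open>Coordinates are n times those along u, so that membership in the lattice expresses
  resolution n by a lattice that does not depend on n. The inequalities are those of
  \<open>sqset_frame_subset_iff\<close>, scaled by n.\<close>

definition quad :: "real^2 \<Rightarrow> real \<Rightarrow> (real \<times> real \<times> real \<times> real) set" where
  "quad u n = {(x, y, s, t). (x, y) \<in> latt u \<and> (s, t) \<in> latt u \<and> 0 < s \<and> 0 \<le> t \<and>
     t \<le> x \<and> x + s \<le> n \<and> 0 \<le> y \<and> y + s + t \<le> n}"

lemma grid_iff:
  assumes "n > 0"
  shows "v \<in> grid n \<longleftrightarrow> (\<forall>i. real n * v $ i \<in> \<int>)"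
proof -
  have "(\<exists>k::int. z = of_int k / of_nat n) \<longleftrightarrow> real n * z \<in> \<int>" for z
    using assms by (auto simp: Ints_def field_simps)
  then show ?thesis by (simp add: grid_def)
qed

text \<open>The grid is an additive group stable under \<open>rot90\<close>, so one corner and one
  side vector decide about all four vertices.\<close>

lemma has_resolution_sqset_iff:
  assumes "n > 0" "w \<noteq> 0"
  shows "has_resolution n (sqset b w) \<longleftrightarrow> b \<in> grid n \<and> w \<in> grid n"
proof
  assume "has_resolution n (sqset b w)"
  then have b: "b \<in> grid n" "b + w \<in> grid n"
    by (auto simp: has_resolution_def extreme_point_of_sqset_iff[OF assms(2)])
  have "real n * w $ i \<in> \<int>" for i
  proof -
    have "real n * (b + w) $ i - real n * b $ i \<in> \<int>"
      using b by (intro Ints_diff) (auto simp: grid_iff[OF assms(1)])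
    then show ?thesis by (simp add: algebra_simps)
  qed
  with b show "b \<in> grid n \<and> w \<in> grid n" by (simp add: grid_iff[OF assms(1)])
next
  assume "b \<in> grid n \<and> w \<in> grid n"
  then show "has_resolution n (sqset b w)"
    by (auto simp: has_resolution_def extreme_point_of_sqset_iff[OF assms(2)] grid_iff[OF assms(1)]
        forall_2 distrib_left right_diff_distrib)
qed

lemma frame_in_grid_iff:
  assumes "n > 0"
  shows "frame u (x / real n) (y / real n) \<in> grid n \<longleftrightarrow> (x, y) \<in> latt u"
proof -
  have "frame u (x / real n) (y / real n) = (1 / real n) *\<^sub>R frame u x y"
    using frame_scale[of u "1 / real n" x y] by simp
  then show ?thesis using assms by (simp add: grid_iff latt_def)
qed

lemma add_in_grid_iff:
  assumes "n > 0" "\<And>i. a $ i \<in> \<int>"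
  shows "a + v \<in> grid n \<longleftrightarrow> v \<in> grid n"
proof -
  have "real n * a $ i \<in> \<int>" for i using assms(2) by simp
  then show ?thesis unfolding grid_iff[OF assms(1)]
    by (simp add: distrib_left)
qed

text \<open>Injectivity is the uniqueness of the canonical parameters. For surjectivity, a miniature
  is similar to a square, hence a square, and therefore has a canonical corner.\<close>

lemma bij_betw_quad_miniatures:
  assumes u: "u \<noteq> 0" and n: "n > 0" and a: "\<And>i. a $ i \<in> \<int>"
  shows "bij_betw (\<lambda>(x, y, s, t). sqset (a + frame u (x / n) (y / n)) (frame u (s / n) (t / n)))
    (quad u n) (miniatures n (sqset a u))" (is "bij_betw ?f _ _")
proof (rule bij_betw_imageI)
  have div_less: "0 < s / real n \<longleftrightarrow> 0 < s" "0 \<le> s / real n \<longleftrightarrow> 0 \<le> s" for s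
    using n by (simp_all add: field_simps)
  show "inj_on ?f (quad u n)"
  proof (rule inj_onI)
    fix v v' assume v: "v \<in> quad u n" "v' \<in> quad u n" "?f v = ?f v'"
    obtain x y s t x' y' s' t' where vv: "v = (x, y, s, t)" "v' = (x', y', s', t')"
      by (cases v, cases v') auto
    have "x / n = x' / n \<and> y / n = y' / n \<and> s / n = s' / n \<and> t / n = t' / n"
      using v unfolding vv by (intro sqset_frame_inject[OF u]) (auto simp: quad_def div_less)
    then show "v = v'" using n by (simp add: vv)
  qed
  have char: "(x, y, s, t) \<in> quad u n \<longleftrightarrow>
      sqset (a + frame u (x / n) (y / n)) (frame u (s / n) (t / n)) \<in> miniatures n (sqset a u)"
    if st: "0 < s" "0 \<le> t" for x y s t
  proof -
    have w: "frame u (s / n) (t / n) \<noteq> 0" using st n by (simp add: frame_eq_0_iff[OF u])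
    have sub: "sqset (a + frame u (x / n) (y / n)) (frame u (s / n) (t / n)) \<subseteq> sqset a u
      \<longleftrightarrow> t \<le> x \<and> x + s \<le> n \<and> 0 \<le> y \<and> y + s + t \<le> n"
      using st n by (subst sqset_frame_subset_iff[OF u]) (simp_all add: field_simps)
    show ?thesis
      using st by (auto simp: miniatures_def miniature_def full_dim_polytope_sqset[OF w] similar_sqset[OF u w]
          sub has_resolution_sqset_iff[OF n w] add_in_grid_iff[OF n a] frame_in_grid_iff[OF n] quad_def)
  qed
  show "?f ` quad u n = miniatures n (sqset a u)"
  proof
    show "?f ` quad u n \<subseteq> miniatures n (sqset a u)"
      using char by (auto simp: quad_def)
    show "miniatures n (sqset a u) \<subseteq> ?f ` quad u n"
    proof
      fix M assume M: "M \<in> miniatures n (sqset a u)"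
      then have "is_square M"
        using is_square_if_similar[of M "sqset a u"] u
        by (auto simp: miniatures_def miniature_def is_square_iff_sqset)
      then obtain b w where "w \<noteq> 0" "M = sqset b w" by (auto simp: is_square_iff_sqset)
      then obtain b' s t where st: "0 < s" "0 \<le> t" "M = sqset b' (frame u s t)"
        using sqset_canonical_corner[OF u] by metis
      obtain x y where "b' - a = frame u x y" using frame_surj[OF u] .
      then have "M = sqset (a + frame u (n * x / n) (n * y / n)) (frame u (n * s / n) (n * t / n))"
        using st(3) n by (simp add: algebra_simps)
      moreover from this have "(n * x, n * y, n * s, n * t) \<in> quad u n"
        using M n st by (subst char) auto
      ultimately show "M \<in> ?f ` quad u n" by (intro rev_image_eqI) auto
    qed
  qed
qed

section \<open>Counting\<close>

text \<open>The analogue of \<open>quad\<close> for Z^2, except that s = 0 is allowed; the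
  comparison maps below make up for this by shifting s by one.\<close>

definition tri :: "int \<Rightarrow> (int \<times> int \<times> int \<times> int) set" where
  "tri N = {(x, y, s, t). 0 \<le> s \<and> 0 \<le> t \<and> t \<le> x \<and> x + s \<le> N \<and> 0 \<le> y \<and> y + s + t \<le> N}"

lemma finite_tri: "finite (tri N)"
proof (rule finite_subset)
  show "tri N \<subseteq> {0..N} \<times> {0..N} \<times> {0..N} \<times> {0..N}" by (auto simp: tri_def)
qed simp

text \<open>The point with parameters \<open>(l, t, x, y)\<close> has bounding box \<open>[x, x + l] \<times> [y, y + l]\<close>.\<close>

lemma sum_tri:
  fixes h :: "real \<Rightarrow> real \<Rightarrow> real"
  shows "(\<Sum>(x, y, s, t)\<in>tri (int N). h (of_int s) (of_int t))
    = (\<Sum>l\<le>N. (real N + 1 - real l)\<^sup>2 * (\<Sum>t\<le>l. h (real l - real t) (real t)))"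
proof -
  let ?D = "Sigma {..N} (\<lambda>l. {..l} \<times> {..N - l} \<times> {..N - l})"
  have "(\<Sum>(x, y, s, t)\<in>tri (int N). h (of_int s) (of_int t))
      = (\<Sum>(l, t, x, y)\<in>?D. h (real l - real t) (real t))"
    \<comment> \<open>Here l = s + t, and x - t replaces x. For fixed l and t the corner of the box
      then ranges freely over (N - l + 1)^2 positions.\<close>
    by (rule sum.reindex_bij_witness[where
          i = "\<lambda>(l, t, x, y). (int x + int t, int y, int l - int t, int t)" and
          j = "\<lambda>(x, y, s, t). (nat (s + t), nat t, nat (x - t), nat y)"])
       (auto simp: tri_def nat_add_distrib)
  also have "\<dots> = (\<Sum>l\<le>N. \<Sum>(t, x, y)\<in>{..l} \<times> {..N - l} \<times> {..N - l}. h (real l - real t) (real t))"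
    by (rule sum.Sigma[symmetric]) auto
  also have "\<dots> = (\<Sum>l\<le>N. (real N + 1 - real l)\<^sup>2 * (\<Sum>t\<le>l. h (real l - real t) (real t)))"
  proof (rule sum.cong[OF refl])
    fix l assume "l \<in> {..N}"
    then have e: "real (card {..N - l}) = real N + 1 - real l" by (simp add: of_nat_diff)
    show "(\<Sum>(t, x, y)\<in>{..l} \<times> {..N - l} \<times> {..N - l}. h (real l - real t) (real t))
        = (real N + 1 - real l)\<^sup>2 * (\<Sum>t\<le>l. h (real l - real t) (real t))"
      unfolding e[symmetric]
      by (simp add: sum.cartesian_product[symmetric] sum_distrib_left[symmetric] power2_eq_square
          mult.assoc del: card_atMost)
  qed
  finally show ?thesis .
qed

lemma sum_tri_1:
  "(\<Sum>(x, y, s, t)\<in>tri (int N). 1::real) = (real N + 1) * (real N + 2)\<^sup>2 * (real N + 3) / 12"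
proof -
  \<comment> \<open>The summand involves N, so induction on the upper limit needs a separate
    constant C. The coefficients of C^2, -2C and 1 are the sums of l + 1 with weights 1, l and
    l^2.\<close>
  have "(\<Sum>l\<le>m. (C - real l)\<^sup>2 * (real l + 1)) = C\<^sup>2 * (real m + 1) * (real m + 2) / 2
      - 2 * C * real m * (real m + 1) * (real m + 2) / 3
      + real m * (real m + 1) * (real m + 2) * (3 * real m + 1) / 12" for C :: real and m
    by (induction m) (simp_all add: field_simps power2_eq_square)
  from this[where m = N and C = "real N + 1"] show ?thesis
    using sum_tri[of "\<lambda>_ _. 1" N] by (simp add: add.commute) (simp add: field_simps power2_eq_square)
qed

lemma sum_tri_squares:
  "(\<Sum>(x, y, s, t)\<in>tri (int N). (real_of_int s)\<^sup>2 + (real_of_int t)\<^sup>2)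
    = (2 * real N ^ 6 + 18 * real N ^ 5 + 65 * real N ^ 4 + 120 * real N ^ 3 + 113 * real N ^ 2 + 42 * real N) / 180"
proof -
  have inner: "(\<Sum>t\<le>l. (C - real t)\<^sup>2 + (real t)\<^sup>2)
      = C\<^sup>2 * (real l + 1) - C * real l * (real l + 1) + real l * (real l + 1) * (2 * real l + 1) / 3" for C l
    by (induction l) (simp_all add: field_simps power2_eq_square)
  \<comment> \<open>For C = l the inner sum is l(l + 1)(2l + 1)/3. The three polynomials in m are
    its sums with weights 1, l and l^2.\<close>
  have "(\<Sum>l\<le>m. (C - real l)\<^sup>2 * (real l * (real l + 1) * (2 * real l + 1) / 3))
      = C\<^sup>2 * (1/6 * real m ^ 4 + 2/3 * real m ^ 3 + 5/6 * real m ^ 2 + 1/3 * real m)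
        - 2 * C * (2/15 * real m ^ 5 + 7/12 * real m ^ 4 + 5/6 * real m ^ 3 + 5/12 * real m ^ 2 + 1/30 * real m)
        + (1/9 * real m ^ 6 + 8/15 * real m ^ 5 + 31/36 * real m ^ 4 + 1/2 * real m ^ 3 + 1/36 * real m ^ 2 - 1/30 * real m)"
    for C :: real and m
    by (induction m) (simp_all add: field_simps power2_eq_square power_numeral_reduce)
  from this[where m = N and C = "real N + 1"]
  have "(\<Sum>l\<le>N. (real N + 1 - real l)\<^sup>2 * (\<Sum>t\<le>l. (real l - real t)\<^sup>2 + (real t)\<^sup>2))
    = (2 * real N ^ 6 + 18 * real N ^ 5 + 65 * real N ^ 4 + 120 * real N ^ 3 + 113 * real N ^ 2 + 42 * real N) / 180"
    unfolding inner by (simp add: power2_eq_square) (simp add: field_simps power_numeral_reduce)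
  then show ?thesis
    using sum_tri[of "\<lambda>s t. s\<^sup>2 + t\<^sup>2" N] by simp
qed

section \<open>Comparison of lattice points with integer points\<close>

lemma sum_le_inj:
  fixes f :: "'a \<Rightarrow> real" and g :: "'b \<Rightarrow> real"
  assumes "finite B" "inj_on k A" "k ` A \<subseteq> B" "\<And>a. a \<in> A \<Longrightarrow> f a \<le> g (k a)" "\<And>b. b \<in> B \<Longrightarrow> 0 \<le> g b"
  shows "sum f A \<le> sum g B"
proof -
  have "sum f A \<le> sum (g \<circ> k) A" using assms(4) by (auto intro: sum_mono)
  also have "\<dots> = sum g (k ` A)" by (simp add: sum.reindex[OF assms(2)])
  also have "\<dots> \<le> sum g B" using assms by (intro sum_mono2) auto
  finally show ?thesis .
qed

text \<open>For integral u these are representatives of the cosets of Z^2 in \<open>latt u\<close>;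
  their number is the k of the overview.\<close>

definition cell :: "real^2 \<Rightarrow> (real \<times> real) set" where
  "cell u = {(x, y) \<in> latt u. 0 \<le> x \<and> x < 1 \<and> 0 \<le> y \<and> y < 1}"

text \<open>The cell embeds into the integer points of a bounded square.\<close>

lemma finite_cell:
  assumes "u \<noteq> 0"
  shows "finite (cell u)"
proof (rule finite_imageD)
  have "bounded (sqset 0 u)"
    using full_dim_polytope_sqset[OF assms] polytope_imp_bounded full_dim_polytope_def by blast
  then have "finite (grid 1 \<inter> sqset 0 u)" by (rule finite_grid_Int_bounded)
  moreover have "(\<lambda>(x, y). frame u x y) ` cell u \<subseteq> grid 1 \<inter> sqset 0 u"
    using mem_sqset_iff[OF assms, of 0] by (auto simp: cell_def latt_def grid_iff)
  ultimately show "finite ((\<lambda>(x, y). frame u x y) ` cell u)" by (rule rev_finite_subset)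
  show "inj_on (\<lambda>(x, y). frame u x y) (cell u)"
    by (auto simp: inj_on_def frame_eq_iff[OF assms])
qed

lemma card_cell_pos: "u \<noteq> 0 \<Longrightarrow> card (cell u) > 0"
  using finite_cell[of u] by (auto simp: card_gt_0_iff cell_def latt_def intro!: exI[of _ 0])

lemma latt_add_int:
  assumes "\<And>i. u $ i \<in> \<int>" "(x, y) \<in> latt u" "k \<in> \<int>" "m \<in> \<int>"
  shows "(x + k, y + m) \<in> latt u"
proof -
  have "\<forall>i. frame u k m $ i \<in> \<int>" using assms by (simp add: forall_2)
  then show ?thesis using assms(2) by (simp add: latt_def frame_add Ints_add del: frame_nth)
qed

lemma frac_cell:
  assumes "\<And>i. u $ i \<in> \<int>" "(x, y) \<in> latt u"
  shows "(frac x, frac y) \<in> cell u"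
  using latt_add_int[OF assms, of "- of_int \<lfloor>x\<rfloor>" "- of_int \<lfloor>y\<rfloor>"]
  by (simp add: cell_def frac_lt_1) (simp add: frac_def)

lemma int_add_unit_eqD:
  fixes a a' :: real
  assumes "of_int k + a = of_int k' + a'" "0 \<le> a" "a < 1" "0 \<le> a'" "a' < 1"
  shows "k = k' \<and> a = a'"
proof -
  have "k = k'" using assms by linarith
  with assms(1) show ?thesis by auto
qed

lemma sum_cell_tri:
  "(\<Sum>(c, d, x, y, s, t)\<in>cell u \<times> cell u \<times> tri N. h s t)
    = (real (card (cell u)))\<^sup>2 * (\<Sum>(x, y, s, t)\<in>tri N. h s t :: real)"
  by (simp add: sum.cartesian_product[symmetric] power2_eq_square mult.assoc)

context
  fixes u :: "real^2" and N :: int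
  assumes u: "u \<noteq> 0" "\<And>i. u $ i \<in> \<int>"
begin

text \<open>Each coordinate splits into floor and fractional part. Adding 1 to the floors of s and t
  makes them upper bounds for a monotone summand, and adding 1 to that of x preserves t <= x. Both x
  + s and y + s + t grow by at most 2, whence N + 2.\<close>

lemma
  shows inj_quad: "inj_on (\<lambda>(x, y, s, t). ((frac x, frac y), (frac s, frac t), \<lfloor>x\<rfloor> + 1, \<lfloor>y\<rfloor>, \<lfloor>s\<rfloor> + 1, \<lfloor>t\<rfloor> + 1))
    (quad u N)" (is "inj_on ?k _")
  and quad_subset: "(\<lambda>(x, y, s, t). ((frac x, frac y), (frac s, frac t), \<lfloor>x\<rfloor> + 1, \<lfloor>y\<rfloor>, \<lfloor>s\<rfloor> + 1, \<lfloor>t\<rfloor> + 1)) ` quad u N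
    \<subseteq> cell u \<times> cell u \<times> tri (N + 2)"
proof -
  show "inj_on ?k (quad u N)"
    by (rule inj_onI) (auto simp: frac_def)
  show "?k ` quad u N \<subseteq> cell u \<times> cell u \<times> tri (N + 2)"
  proof (rule image_subsetI)
    fix v assume "v \<in> quad u N"
    moreover obtain x y s t where v: "v = (x, y, s, t)" by (cases v)
    ultimately have q: "(x, y, s, t) \<in> quad u N" by simp
    then have "(frac x, frac y) \<in> cell u" "(frac s, frac t) \<in> cell u"
      by (auto simp: quad_def intro!: frac_cell u)
    moreover have "\<lfloor>t\<rfloor> \<le> \<lfloor>x\<rfloor>" "0 \<le> \<lfloor>s\<rfloor>" "0 \<le> \<lfloor>t\<rfloor>" "0 \<le> \<lfloor>y\<rfloor>"
      using q by (auto simp: quad_def intro: floor_mono)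
    moreover have "\<lfloor>x\<rfloor> + \<lfloor>s\<rfloor> \<le> N" "\<lfloor>y\<rfloor> + \<lfloor>s\<rfloor> + \<lfloor>t\<rfloor> \<le> N"
      using q unfolding quad_def mem_Collect_eq prod.case by linarith+
    ultimately show "?k v \<in> cell u \<times> cell u \<times> tri (N + 2)"
      by (auto simp: v tri_def)
  qed
qed

lemma finite_quad: "finite (quad u N)"
  using inj_on_finite[OF inj_quad quad_subset] finite_cell[OF u(1)] finite_tri by blast

lemma sum_quad_le:
  fixes h :: "real \<Rightarrow> real \<Rightarrow> real"
  assumes mono: "\<And>s t s' t'. 0 \<le> s \<Longrightarrow> s \<le> s' \<Longrightarrow> 0 \<le> t \<Longrightarrow> t \<le> t' \<Longrightarrow> h s t \<le> h s' t'"
    and nonneg: "\<And>s t. 0 \<le> h s t"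
  shows "(\<Sum>(x, y, s, t)\<in>quad u N. h s t) \<le>
    (real (card (cell u)))\<^sup>2 * (\<Sum>(x, y, s, t)\<in>tri (N + 2). h (of_int s) (of_int t))"
  unfolding sum_cell_tri[symmetric]
proof (rule sum_le_inj[OF _ inj_quad quad_subset])
  fix v assume "v \<in> quad u N"
  then obtain x y s t where v: "v = (x, y, s, t)" "0 < s" "0 \<le> t" by (auto simp: quad_def)
  have "h s t \<le> h (of_int (\<lfloor>s\<rfloor> + 1)) (of_int (\<lfloor>t\<rfloor> + 1))"
    using v by (intro mono) linarith+
  then show "(case v of (x, y, s, t) \<Rightarrow> h s t) \<le> (case (case v of (x, y, s, t) \<Rightarrow>
      ((frac x, frac y), (frac s, frac t), \<lfloor>x\<rfloor> + 1, \<lfloor>y\<rfloor>, \<lfloor>s\<rfloor> + 1, \<lfloor>t\<rfloor> + 1)) of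
        (c, d, x, y, s, t) \<Rightarrow> h (of_int s) (of_int t))"
    by (simp add: v)
qed (use finite_cell[OF u(1)] finite_tri nonneg in auto)

lemma sum_quad_ge:
  fixes h :: "real \<Rightarrow> real \<Rightarrow> real"
  assumes mono: "\<And>s t s' t'. 0 \<le> s \<Longrightarrow> s \<le> s' \<Longrightarrow> 0 \<le> t \<Longrightarrow> t \<le> t' \<Longrightarrow> h s t \<le> h s' t'"
    and nonneg: "\<And>s t. 0 \<le> h s t"
  shows "(real (card (cell u)))\<^sup>2 * (\<Sum>(x, y, s, t)\<in>tri (N - 4). h (of_int s) (of_int t))
    \<le> (\<Sum>(x, y, s, t)\<in>quad u N. h s t)"
  unfolding sum_cell_tri[symmetric]
proof (rule sum_le_inj[OF finite_quad])
  \<comment> \<open>The shift of s makes it strictly positive, and the shift of x makes room for d <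
    1 in t <= x. With the fractional parts, x + s and y + s + t grow by less than 4, whence N - 4.
    Neither s nor t decreases, as the monotone summand requires.\<close>
  let ?k = "\<lambda>((a, b), (c, d), x, y, s, t).
    (of_int (x + 1) + a, of_int y + b, of_int (s + 1) + c, of_int t + d) :: real \<times> real \<times> real \<times> real"
  show "inj_on ?k (cell u \<times> cell u \<times> tri (N - 4))"
    by (rule inj_onI) (auto simp: cell_def simp del: of_int_add dest!: int_add_unit_eqD)
  show "?k ` (cell u \<times> cell u \<times> tri (N - 4)) \<subseteq> quad u N"
  proof (rule image_subsetI)
    fix v assume "v \<in> cell u \<times> cell u \<times> tri (N - 4)"
    then obtain a b c d x y s t where v: "v = ((a, b), (c, d), x, y, s, t)"
      and ab: "(a, b) \<in> cell u" and cd: "(c, d) \<in> cell u" and T: "(x, y, s, t) \<in> tri (N - 4)"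
      by (cases v) auto
    have "(a + of_int (x + 1), b + of_int y) \<in> latt u" "(c + of_int (s + 1), d + of_int t) \<in> latt u"
      using ab cd by (auto simp: cell_def intro!: latt_add_int u)
    then have L: "(of_int (x + 1) + a, of_int y + b) \<in> latt u" "(of_int (s + 1) + c, of_int t + d) \<in> latt u"
      by (simp_all only: add.commute)
    have T': "0 \<le> s" "0 \<le> t" "t \<le> x" "x + s \<le> N - 4" "0 \<le> y" "y + s + t \<le> N - 4"
      using T by (auto simp: tri_def)
    have b: "0 \<le> a" "a < 1" "0 \<le> b" "b < 1" "0 \<le> c" "c < 1" "0 \<le> d" "d < 1"
      using ab cd by (auto simp: cell_def)
    have "0 < of_int (s + 1) + c" "0 \<le> of_int t + d" "of_int t + d \<le> of_int (x + 1) + a"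
      "of_int (x + 1) + a + (of_int (s + 1) + c) \<le> of_int N" "0 \<le> of_int y + b"
      "of_int y + b + (of_int (s + 1) + c) + (of_int t + d) \<le> of_int N"
      using T' b by linarith+
    with L show "?k v \<in> quad u N"
      by (simp add: v quad_def)
  qed
  fix v assume "v \<in> cell u \<times> cell u \<times> tri (N - 4)"
  then obtain a b c d x y s t where v: "v = ((a, b), (c, d), x, y, s, t)"
    and b: "0 \<le> c" "0 \<le> d" "0 \<le> s" "0 \<le> t" by (auto simp: cell_def tri_def)
  have "h (of_int s) (of_int t) \<le> h (of_int (s + 1) + c) (of_int t + d)"
    using b by (intro mono) auto
  then show "(case v of (c, d, x, y, s, t) \<Rightarrow> h (of_int s) (of_int t)) \<le>
      (case ?k v of (x, y, s, t) \<Rightarrow> h s t)"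
    by (simp add: v)
qed (use nonneg in auto)

end

section \<open>The average\<close>

lemma miniature_average_eq:
  assumes u: "u \<noteq> 0" and a: "\<And>i. a $ i \<in> \<int>" and n: "n > 0"
  shows "miniature_average (sqset a u) n = measure lebesgue (sqset a u) / (real n)\<^sup>2 *
    (\<Sum>(x, y, s, t)\<in>quad u n. s\<^sup>2 + t\<^sup>2) / (\<Sum>(x, y, s, t)\<in>quad u n. 1)"
proof -
  let ?A = "measure lebesgue (sqset a u)"
  note bij = bij_betw_quad_miniatures[OF u n a]
  have "(\<Sum>M\<in>miniatures n (sqset a u). measure lebesgue M)
      = (\<Sum>(x, y, s, t)\<in>quad u n. measure lebesgue (sqset (a + frame u (x / n) (y / n)) (frame u (s / n) (t / n))))"
    by (subst sum.reindex_bij_betw[OF bij, symmetric]) (simp add: case_prod_unfold)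
  also have "\<dots> = (\<Sum>(x, y, s, t)\<in>quad u n. ?A / (real n)\<^sup>2 * (s\<^sup>2 + t\<^sup>2))"
    by (simp add: measure_sqset_frame[where a = a] power_divide mult.commute flip: add_divide_distrib)
  also have "\<dots> = ?A / (real n)\<^sup>2 * (\<Sum>(x, y, s, t)\<in>quad u n. s\<^sup>2 + t\<^sup>2)"
    by (simp add: sum_distrib_left case_prod_unfold)
  finally show ?thesis
    unfolding miniature_average_def bij_betw_same_card[OF bij, symmetric] by (simp add: case_prod_unfold)
qed

text \<open>Sum and count are each enclosed between multiples of explicit polynomials with the same
  factor K, which cancels in the quotient.\<close>

lemma miniature_average_sqset_tendsto:
  assumes u: "u \<noteq> 0" "\<And>i. u $ i \<in> \<int>" and a: "\<And>i. a $ i \<in> \<int>"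
  shows "miniature_average (sqset a u) \<longlonglongrightarrow> 2 / 15 * measure lebesgue (sqset a u)"
proof -
  define A where "A = measure lebesgue (sqset a u)"
  define K where "K = (real (card (cell u)))\<^sup>2"
  define G where "G = (\<lambda>x::real. (x + 1) * (x + 2)\<^sup>2 * (x + 3) / 12)"
  define H where "H = (\<lambda>x::real. (2 * x ^ 6 + 18 * x ^ 5 + 65 * x ^ 4 + 120 * x ^ 3 + 113 * x ^ 2 + 42 * x) / 180)"
  have A: "A \<ge> 0" by (simp add: A_def)
  have K: "K > 0" using card_cell_pos[OF u(1)] by (simp add: K_def)
  have bounds: "A / (real n)\<^sup>2 * (H (real n - 4) / G (real n + 2)) \<le> miniature_average (sqset a u) n \<and>
      miniature_average (sqset a u) n \<le> A / (real n)\<^sup>2 * (H (real n + 2) / G (real n - 4))" if n: "n \<ge> 4" for n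
  proof -
    define W where "W = (\<Sum>(x, y, s, t)\<in>quad u n. s\<^sup>2 + t\<^sup>2)"
    define C where "C = (\<Sum>(x, y, s, t)\<in>quad u n. 1::real)"
    \<comment> \<open>The closed forms are stated for natural arguments; n >= 4 makes n - 4 one of
      them.\<close>
    have i: "int n + 2 = int (n + 2)" "int n - 4 = int (n - 4)" using n by auto
    have C: "K * G (real n - 4) \<le> C" "C \<le> K * G (real n + 2)"
      using sum_quad_ge[OF u, of "\<lambda>_ _. 1" "int n"] sum_quad_le[OF u, of "\<lambda>_ _. 1" "int n"] n
      unfolding i sum_tri_1 by (simp_all add: C_def K_def G_def of_nat_diff)
    have W: "K * H (real n - 4) \<le> W" "W \<le> K * H (real n + 2)"
      using sum_quad_ge[OF u, of "\<lambda>s t. s\<^sup>2 + t\<^sup>2" "int n"] sum_quad_le[OF u, of "\<lambda>s t. s\<^sup>2 + t\<^sup>2" "int n"] n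
      unfolding i sum_tri_squares by (simp_all add: W_def K_def H_def of_nat_diff add_mono power_mono add.commute)
    have G: "G (real n - 4) > 0" and H: "H (real n - 4) \<ge> 0" using n by (simp_all add: G_def H_def)
    have pos: "0 < K * G (real n - 4)" using K G by simp
    have "0 \<le> K * H (real n - 4)" using K H by simp
    then have W0: "0 \<le> W" using W by linarith
    have "K * H (real n - 4) / (K * G (real n + 2)) \<le> W / C"
      using C W W0 pos by (intro frac_le) auto
    moreover have "W / C \<le> K * H (real n + 2) / (K * G (real n - 4))"
      using C W W0 pos by (intro frac_le) auto
    ultimately have "H (real n - 4) / G (real n + 2) \<le> W / C" "W / C \<le> H (real n + 2) / G (real n - 4)"
      using K by simp_all
    moreover have "miniature_average (sqset a u) n = A / (real n)\<^sup>2 * (W / C)"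
      using miniature_average_eq[OF u(1) a, of n] n by (simp add: A_def W_def C_def)
    moreover have "0 \<le> A / (real n)\<^sup>2" using A by simp
    ultimately show ?thesis by (metis mult_left_mono)
  qed
  \<comment> \<open>H has leading term x^6/90 and G has x^4/12. The constant shifts do not affect
    these terms, so the limit is 12/90.\<close>
  have "(\<lambda>n. 1 / (real n)\<^sup>2 * (H (real n - 4) / G (real n + 2))) \<longlonglongrightarrow> 2 / 15"
    unfolding G_def H_def by real_asymp
  then have 1: "(\<lambda>n. A / (real n)\<^sup>2 * (H (real n - 4) / G (real n + 2))) \<longlonglongrightarrow> 2 / 15 * A"
    by (auto dest: tendsto_mult_left[of _ _ _ A] simp: mult.commute)
  have "(\<lambda>n. 1 / (real n)\<^sup>2 * (H (real n + 2) / G (real n - 4))) \<longlonglongrightarrow> 2 / 15"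
    unfolding G_def H_def by real_asymp
  then have 2: "(\<lambda>n. A / (real n)\<^sup>2 * (H (real n + 2) / G (real n - 4))) \<longlonglongrightarrow> 2 / 15 * A"
    by (auto dest: tendsto_mult_left[of _ _ _ A] simp: mult.commute)
  show ?thesis
    unfolding A_def[symmetric]
    by (rule tendsto_sandwich[OF _ _ 1 2]) (use bounds in \<open>auto intro!: eventually_sequentiallyI[of 4]\<close>)
qed

theorem theorem2:
  fixes P :: "(real^2) set" and A :: real
  assumes "lattice_square P"
    and "A = measure lebesgue P"
  shows "mu_av_measurable P \<and> mu_av P = 2 / 15 * A"
proof -
  obtain a u where u: "u \<noteq> 0" and P: "P = sqset a u"
    and int: "\<And>x i. x extreme_point_of P \<Longrightarrow> x $ i \<in> \<int>"
    using assms(1) by (auto simp: lattice_square_def is_square_iff_sqset)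
  have a: "a $ i \<in> \<int>" and au: "(a + u) $ i \<in> \<int>" for i
    using int[of a] int[of "a + u"] by (auto simp: P extreme_point_of_sqset_iff[OF u])
  have "u $ i \<in> \<int>" for i
    using Ints_diff[OF au a, of i i] by simp
  then have "miniature_average P \<longlonglongrightarrow> 2 / 15 * A"
    unfolding assms(2) P by (intro miniature_average_sqset_tendsto u a)
  moreover have "lattice_polytope P"
    using full_dim_polytope_sqset[OF u] int by (simp add: lattice_polytope_def P)
  ultimately show ?thesis
    unfolding mu_av_measurable_def mu_av_def using convergentI limI by blast
qed

end
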